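(* Let $X$ be a Hausdorff locally convex topological vector space, let $K$ be a nonempty convex closed subset of $X$, let $D\subseteq K$ be a self segment-dense set in $K$, and let $\varphi:K\times K\to\mathbb{R}$ be a function satisfying: (i) for all $y\in D$, the function $x\mapsto\varphi(x,y)$ is upper semicontinuous on $K$; (ii) for all $x\in K$, the function $y\mapsto\varphi(x,y)$ is upper semicontinuous on $K\setminus D$; (iii) for all $x\in D$, the function $y\mapsto\varphi(x,y)$ is convex on $D$; (iv) for all $x\in D$, $\varphi(x,x)\ge0$; (v) there exist a compact set $K_0\subseteq X$ and $y_0\in D\cap K_0$ such that $\varphi(x,y_0)<0$ for all $x\in K\setminus K_0$. Then there exists $x_0\in K$ such that $\varphi(x_0,y)\ge0$ for all $y\in K$.
   Context: Self segment-dense: for $U\subseteq V\subseteq X$ with $V$ convex, $U$ is self segment-dense in $V$ if $U$ is dense in $V$ (i.e. $V\subseteq\operatorname{cl}(U)$) and for all $x,y\in U$ the set $[x,y]\cap U$ is dense in the closed segment $[x,y]=\{x+t(y-x):t\in[0,1]\}$. A function on $K$ is upper semicontinuous on $S\subseteq K$ if, as a function on $K$, it is upper semicontinuous at each point of $S$. A real function $f$ is convex on a (not necessarily convex) set $D$ if for all $x_1,\dots,x_n\in D$ and $\lambda_i\ge0$ with $\sum_{i=1}^n\lambda_i=1$ and $\sum_{i=1}^n\lambda_ix_i\in D$ one has $\sum_{i=1}^n\lambda_if(x_i)\ge f\left(\sum_{i=1}^n\lambda_ix_i\right)$. *)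

theory Defs
  imports "HOL-Analysis.Analysis"
begin

class topological_real_vector = real_vector + topological_ab_group_add +
  assumes tendsto_scaleR_Pair:
    "LIM z (nhds c \<times>\<^sub>F nhds x). fst z *\<^sub>R snd z :> nhds (c *\<^sub>R x)"

text \<open>Convex neighbourhoods of the origin form a neighbourhood base there. A class axiom cannot
  mention \<open>convex\<close> and \<open>interior\<close>, whose types already carry a sort, so both are unfolded;
  \<open>locally_convex_space_nhds\<close> restates the axiom. The Hausdorff axiom is not part of the class;
  it is obtained by adding the sort \<open>t2_space\<close>.\<close>

class locally_convex_space = topological_real_vector +
  assumes convex_nhds_base_raw:
    "open U \<Longrightarrow> 0 \<in> U \<Longrightarrow>
     \<exists>V. (\<forall>x\<in>V. \<forall>y\<in>V. \<forall>u\<ge>0. \<forall>v\<ge>0. u + v = 1 \<longrightarrow> u *\<^sub>R x + v *\<^sub>R y \<in> V) \<and>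
         (\<exists>W. open W \<and> 0 \<in> W \<and> W \<subseteq> V) \<and> V \<subseteq> U"

lemma locally_convex_space_nhds:
  fixes U :: "'a::locally_convex_space set"
  assumes "open U" "0 \<in> U"
  obtains V where "convex V" "0 \<in> interior V" "V \<subseteq> U"
  using convex_nhds_base_raw[OF assms] unfolding convex_def interior_def by blast

instance real_normed_vector < locally_convex_space
proof
  fix c :: real and x :: 'a
  show "LIM z (nhds c \<times>\<^sub>F nhds x). fst z *\<^sub>R snd z :> nhds (c *\<^sub>R x)"
    by (intro tendsto_scaleR filterlim_fst filterlim_snd)
next
  fix U :: "'a set"
  assume "open U" "0 \<in> U"
  then obtain e where "e > 0" "ball 0 e \<subseteq> U"
    by (meson openE)
  moreover have "convex (ball (0::'a) e)" by simp
  ultimately show "\<exists>V. (\<forall>x\<in>V. \<forall>y\<in>V. \<forall>u\<ge>0. \<forall>v\<ge>0. u + v = 1 \<longrightarrow> u *\<^sub>R x + v *\<^sub>R y \<in> V) \<and>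
         (\<exists>W. open W \<and> 0 \<in> W \<and> W \<subseteq> V) \<and> V \<subseteq> U"
    unfolding convex_def by (metis centre_in_ball open_ball order_refl)
qed

definition self_segment_dense_in ::
    "'a::{real_vector,topological_space} set \<Rightarrow> 'a set \<Rightarrow> bool" where
  "self_segment_dense_in U V \<longleftrightarrow>
     convex V \<and> U \<subseteq> V \<and> V \<subseteq> closure U \<and>
     (\<forall>x\<in>U. \<forall>y\<in>U. closed_segment x y \<subseteq> closure (closed_segment x y \<inter> U))"

text \<open>Upper semicontinuity at the points of \<open>S\<close> of \<open>f\<close> regarded as a function on \<open>K\<close>: the
  approaching points range over \<open>K\<close>, not over \<open>S\<close>. Values of \<open>f\<close> outside \<open>K\<close> are irrelevant
  when \<open>S \<subseteq> K\<close>.\<close>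

definition upper_semicontinuous_at_within ::
    "'a::topological_space \<Rightarrow> 'a set \<Rightarrow> ('a \<Rightarrow> real) \<Rightarrow> bool" where
  "upper_semicontinuous_at_within x K f \<longleftrightarrow>
     (\<forall>a > f x. eventually (\<lambda>z. f z < a) (at x within K))"

definition upper_semicontinuous_on ::
    "'a::topological_space set \<Rightarrow> 'a set \<Rightarrow> ('a \<Rightarrow> real) \<Rightarrow> bool" where
  "upper_semicontinuous_on K S f \<longleftrightarrow> (\<forall>x\<in>S. upper_semicontinuous_at_within x K f)"

text \<open>Unlike \<open>convex_on\<close>, this does not require \<open>D\<close> to be convex; on such sets the inequality for
  two points does not yield the one for \<open>n\<close> points, hence the finite families.\<close>

definition convex_fun_on :: "'a::real_vector set \<Rightarrow> ('a \<Rightarrow> real) \<Rightarrow> bool" where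
  "convex_fun_on D f \<longleftrightarrow>
     (\<forall>(n::nat) (x::nat \<Rightarrow> 'a) (l::nat \<Rightarrow> real).
        (\<forall>i\<in>{1..n}. x i \<in> D) \<longrightarrow> (\<forall>i\<in>{1..n}. l i \<ge> 0) \<longrightarrow>
        (\<Sum>i=1..n. l i) = 1 \<longrightarrow> (\<Sum>i=1..n. l i *\<^sub>R x i) \<in> D \<longrightarrow>
        (\<Sum>i=1..n. l i * f (x i)) \<ge> f (\<Sum>i=1..n. l i *\<^sub>R x i))"

end

theory Submission
  imports Defs
begin

text \<open>For \<open>y \<in> D\<close> the sets \<open>{x \<in> K. \<phi> x y \<ge> 0}\<close> are closed, and by (iii) and (iv) those belonging to
  a finite \<open>T \<subseteq> D\<close> cover \<open>D \<inter> convex hull T\<close>. Self segment-density makes this set dense in the hull, so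
  they cover the hull as well: they form a KKM family, and with (v) compactness gives a common point
  \<open>x0\<close>. Condition (ii) extends \<open>\<phi> x0 y \<ge> 0\<close> from the dense set \<open>D\<close> to \<open>K\<close>.

  The dimension of the simplex in the KKM theorem is a bound variable, so Brouwer's theorem for
  euclidean spaces given by types does not apply. It is derived from Kuhn's combinatorial lemma for
  cubes inside \<open>nat \<Rightarrow> real\<close> instead.\<close>

section \<open>Brouwer's fixed point theorem for cubes of variable dimension\<close>

definition cube_upto :: "nat \<Rightarrow> (nat \<Rightarrow> real) set" where
  "cube_upto n = {x. (\<forall>i<n. 0 \<le> x i \<and> x i \<le> 1) \<and> (\<forall>i\<ge>n. x i = 0)}"

lemma tendsto_fun_iff:
  fixes X :: "'c \<Rightarrow> 'i \<Rightarrow> 'b::topological_space"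
  shows "(X \<longlongrightarrow> x) F \<longleftrightarrow> (\<forall>i. ((\<lambda>k. X k i) \<longlongrightarrow> x i) F)"
  using limitin_componentwise[of "\<lambda>_. euclidean" UNIV X x F]
  by (simp add: euclidean_product_topology)

text \<open>Tychonoff: pinning the coordinates from \<open>n\<close> on to 0 turns the cube into a
  product of compact factors, so no dimension needs to be encoded in a type.\<close>

lemma compact_cube_upto: "compact (cube_upto n)"
proof -
  have "x \<in> cube_upto n \<longleftrightarrow> x \<in> (\<Pi>\<^sub>E i\<in>UNIV. if i < n then {0..1} else {0})" for x
    unfolding cube_upto_def PiE_UNIV_domain Pi_iff
    by (simp add: all_conj_distrib not_less if_distrib)
  then have "cube_upto n = (\<Pi>\<^sub>E i\<in>UNIV. if i < n then {0..1} else {0})" by blast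
  moreover have "compactin (product_topology (\<lambda>_. euclidean) UNIV)
      (\<Pi>\<^sub>E i\<in>UNIV. if i < n then {0..1} else {0::real})"
    unfolding compactin_PiE by (intro disjI2 ballI) simp
  ultimately show ?thesis
    by (simp only: euclidean_product_topology compactin_euclidean_iff)
qed

text \<open>The points \<open>r\<close> and \<open>s\<close> converge to the same limit as the mesh shrinks, so the two opposite
  inequalities force a fixed point.\<close>

lemma brouwer_grid_step:
  fixes f :: "(nat \<Rightarrow> real) \<Rightarrow> nat \<Rightarrow> real"
  assumes f: "\<And>x. x \<in> cube_upto n \<Longrightarrow> f x \<in> cube_upto n" and "0 < p"
  shows "\<exists>q\<in>cube_upto n. \<forall>i<n. \<exists>r\<in>cube_upto n. \<exists>s\<in>cube_upto n.
    (\<forall>j. \<bar>r j - q j\<bar> \<le> 1 / real p) \<and> (\<forall>j. \<bar>s j - q j\<bar> \<le> 1 / real p) \<and> r i \<le> f r i \<and> f s i \<le> s i"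
proof -
  define e where "e q = (\<lambda>i. if i < n then real (q i) / real p else 0)" for q :: "nat \<Rightarrow> nat"
  \<comment> \<open>Label 0 records that \<open>f\<close> does not lower coordinate
    \<open>i\<close>, label 1 that it does not raise it. On the faces \<open>q i = 0\<close> and
    \<open>q i = p\<close> the label is forced, as Kuhn's lemma demands; both inequalities remain
    true there because \<open>f\<close> stays in the cube.\<close>
  define label where "label q i = (if q i = 0 \<or> (q i < p \<and> e q i \<le> f (e q) i) then 0 else 1::nat)" for q i
  have e: "e q \<in> cube_upto n" if "\<forall>i<n. q i \<le> p" for q
    using that \<open>0 < p\<close> by (auto simp: cube_upto_def e_def)
  have fe: "0 \<le> f (e q) i" "f (e q) i \<le> 1" if "\<forall>i<n. q i \<le> p" "i < n" for q i
    using f[OF e[OF that(1)]] that(2) by (auto simp: cube_upto_def)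
  have lab0: "e q i \<le> f (e q) i" if "\<forall>i<n. q i \<le> p" "i < n" "label q i = 0" for q i
    using that fe[OF that(1,2)] by (auto simp: label_def e_def split: if_splits)
  have lab1: "f (e q) i \<le> e q i" if "\<forall>i<n. q i \<le> p" "i < n" "label q i \<noteq> 0" for q i
  proof (cases "q i < p")
    case True
    then show ?thesis using that(3) by (auto simp: label_def split: if_splits)
  next
    case False
    then have "q i = p" using that(1,2) by (metis le_neq_implies_less)
    then have "e q i = 1" using that(2) \<open>0 < p\<close> by (simp add: e_def)
    then show ?thesis using fe[OF that(1,2)] by simp
  qed
  obtain q where q: "\<forall>i<n. q i < p"
    and rs: "\<forall>i<n. \<exists>r s. (\<forall>j<n. q j \<le> r j \<and> r j \<le> q j + 1) \<and>
      (\<forall>j<n. q j \<le> s j \<and> s j \<le> q j + 1) \<and> label r i \<noteq> label s i"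
    by (rule kuhn_lemma[of p n label]) (use \<open>0 < p\<close> in \<open>auto simp: label_def\<close>)
  have near: "\<bar>e r j - e q j\<bar> \<le> 1 / real p" if "\<forall>j<n. q j \<le> r j \<and> r j \<le> q j + 1" for r j
  proof (cases "j < n")
    case True
    then have "real (q j) \<le> real (r j)" "real (r j) \<le> real (q j) + 1"
      using that by force+
    then show ?thesis
      using True \<open>0 < p\<close> by (simp add: e_def abs_le_iff divide_simps)
  qed (simp add: e_def)
  have le_p: "\<forall>i<n. r i \<le> p" if "\<forall>j<n. q j \<le> r j \<and> r j \<le> q j + 1" for r
    using that q by (metis Suc_eq_plus1 Suc_leI le_trans)
  show ?thesis
  proof (rule bexI[of _ "e q"], intro allI impI)
    show "e q \<in> cube_upto n" using q by (intro e) (simp add: less_imp_le)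
  next
    fix i assume "i < n"
    then obtain r s where r: "\<forall>j<n. q j \<le> r j \<and> r j \<le> q j + 1"
      and s: "\<forall>j<n. q j \<le> s j \<and> s j \<le> q j + 1" and rs: "label r i \<noteq> label s i"
      using rs by blast
    \<comment> \<open>Kuhn's lemma says only that the two labels differ, not which one is 0.
      Generality in \<open>r\<close> and \<open>s\<close> allows them to be swapped.\<close>
    have *: "\<exists>r\<in>cube_upto n. \<exists>s\<in>cube_upto n. (\<forall>j. \<bar>r j - e q j\<bar> \<le> 1 / real p) \<and>
      (\<forall>j. \<bar>s j - e q j\<bar> \<le> 1 / real p) \<and> r i \<le> f r i \<and> f s i \<le> s i"
      if "\<forall>j<n. q j \<le> r j \<and> r j \<le> q j + 1" "\<forall>j<n. q j \<le> s j \<and> s j \<le> q j + 1"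
        "label r i = 0" "label s i \<noteq> 0" for r s
      using that near le_p e lab0[OF _ \<open>i < n\<close>] lab1[OF _ \<open>i < n\<close>]
      by (intro bexI[of _ "e r"] bexI[of _ "e s"]) auto
    show "\<exists>r\<in>cube_upto n. \<exists>s\<in>cube_upto n. (\<forall>j. \<bar>r j - e q j\<bar> \<le> 1 / real p) \<and>
      (\<forall>j. \<bar>s j - e q j\<bar> \<le> 1 / real p) \<and> r i \<le> f r i \<and> f s i \<le> s i"
    proof (cases "label r i = 0")
      case True
      then show ?thesis using *[OF r s] rs by simp
    next
      case False
      moreover from this rs have "label s i = 0" by (auto simp: label_def split: if_splits)
      ultimately show ?thesis using *[OF s r] by simp
    qed
  qed
qed

theorem brouwer_cube_upto:
  assumes cont: "continuous_on (cube_upto n) f"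
    and f: "\<And>x. x \<in> cube_upto n \<Longrightarrow> f x \<in> cube_upto n"
  obtains x where "x \<in> cube_upto n" "f x = x"
proof -
  have "\<forall>m. \<exists>q\<in>cube_upto n. \<forall>i<n. \<exists>r\<in>cube_upto n. \<exists>s\<in>cube_upto n.
    (\<forall>j. \<bar>r j - q j\<bar> \<le> 1 / real (Suc m)) \<and> (\<forall>j. \<bar>s j - q j\<bar> \<le> 1 / real (Suc m)) \<and>
    r i \<le> f r i \<and> f s i \<le> s i"
    using brouwer_grid_step[of n f, OF f zero_less_Suc] by blast
  then obtain q where q: "\<And>m. q m \<in> cube_upto n"
    and "\<And>m. \<forall>i<n. \<exists>r\<in>cube_upto n. \<exists>s\<in>cube_upto n.
    (\<forall>j. \<bar>r j - q m j\<bar> \<le> 1 / real (Suc m)) \<and> (\<forall>j. \<bar>s j - q m j\<bar> \<le> 1 / real (Suc m)) \<and>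
    r i \<le> f r i \<and> f s i \<le> s i"
    by metis
  then have ex: "\<forall>i m. \<exists>r s. i < n \<longrightarrow> r \<in> cube_upto n \<and> s \<in> cube_upto n \<and>
    (\<forall>j. \<bar>r j - q m j\<bar> \<le> 1 / real (Suc m)) \<and> (\<forall>j. \<bar>s j - q m j\<bar> \<le> 1 / real (Suc m)) \<and>
    r i \<le> f r i \<and> f s i \<le> s i"
    by blast
  obtain r s where rs: "\<And>i m. i < n \<Longrightarrow> r i m \<in> cube_upto n \<and> s i m \<in> cube_upto n \<and>
    (\<forall>j. \<bar>r i m j - q m j\<bar> \<le> 1 / real (Suc m)) \<and> (\<forall>j. \<bar>s i m j - q m j\<bar> \<le> 1 / real (Suc m)) \<and>
    r i m i \<le> f (r i m) i \<and> f (s i m) i \<le> s i m i"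
    using ex by metis
  obtain x k where x: "x \<in> cube_upto n" and "strict_mono k" and lim: "(q \<circ> k) \<longlonglongrightarrow> x"
    using compact_cube_upto[of n] q unfolding compact_def by metis
  have inv: "(\<lambda>m. 1 / real (Suc (k m))) \<longlonglongrightarrow> 0"
    using LIMSEQ_subseq_LIMSEQ[OF LIMSEQ_Suc[OF lim_1_over_n] \<open>strict_mono k\<close>]
    by (simp add: o_def)
  \<comment> \<open>The subsequence \<open>k\<close> is chosen for the cell corners \<open>q\<close>
    alone. The mesh bound makes every sequence of nearby points follow, so one \<open>k\<close>
    serves all coordinates \<open>i\<close>.\<close>
  have near: "(\<lambda>m. u (k m)) \<longlonglongrightarrow> x" if "\<And>m j. \<bar>u m j - q m j\<bar> \<le> 1 / real (Suc m)" for u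
    unfolding tendsto_fun_iff
  proof
    fix j
    have "(\<lambda>m. u (k m) j - q (k m) j) \<longlonglongrightarrow> 0"
      by (rule Lim_null_comparison[OF _ inv]) (use that in simp)
    moreover have "(\<lambda>m. q (k m) j) \<longlonglongrightarrow> x j"
      using lim by (simp add: tendsto_fun_iff o_def)
    ultimately show "(\<lambda>m. u (k m) j) \<longlonglongrightarrow> x j"
      using tendsto_add by fastforce
  qed
  have flim: "(\<lambda>m. f (u m) i) \<longlonglongrightarrow> f x i"
    if "u \<longlonglongrightarrow> x" "\<And>m. u m \<in> cube_upto n" for u i
  proof -
    have "(\<lambda>m. f (u m)) \<longlonglongrightarrow> f x"
      by (rule continuous_on_tendsto_compose[OF cont that(1) x]) (use that(2) in simp)
    then show ?thesis by (simp add: tendsto_fun_iff)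
  qed
  have "f x i = x i" for i
  proof (cases "i < n")
    case True
    have r: "(\<lambda>m. r i (k m)) \<longlonglongrightarrow> x" and s: "(\<lambda>m. s i (k m)) \<longlonglongrightarrow> x"
      using rs[OF True] by (auto intro: near)
    have "x i \<le> f x i"
    proof (rule LIMSEQ_le)
      show "(\<lambda>m. r i (k m) i) \<longlonglongrightarrow> x i" using r by (simp add: tendsto_fun_iff)
      show "(\<lambda>m. f (r i (k m)) i) \<longlonglongrightarrow> f x i" using flim[OF r] rs[OF True] by blast
    qed (use rs[OF True] in blast)
    moreover have "f x i \<le> x i"
    proof (rule LIMSEQ_le)
      show "(\<lambda>m. s i (k m) i) \<longlonglongrightarrow> x i" using s by (simp add: tendsto_fun_iff)
      show "(\<lambda>m. f (s i (k m)) i) \<longlonglongrightarrow> f x i" using flim[OF s] rs[OF True] by blast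
    qed (use rs[OF True] in blast)
    ultimately show ?thesis by simp
  next
    case False
    then show ?thesis using x f[OF x] by (simp add: cube_upto_def)
  qed
  with x that show thesis by blast
qed

section \<open>The KKM theorem for closed sets in a topological vector space\<close>

lemma continuous_on_scaleR_topological:
  fixes f :: "'b::topological_space \<Rightarrow> real" and g :: "'b \<Rightarrow> 'a::topological_real_vector"
  assumes "continuous_on S f" "continuous_on S g"
  shows "continuous_on S (\<lambda>x. f x *\<^sub>R g x)"
  unfolding continuous_on_def
proof
  fix x assume "x \<in> S"
  then have "(f \<longlongrightarrow> f x) (at x within S)" "(g \<longlongrightarrow> g x) (at x within S)"
    using assms by (auto simp: continuous_on_def)
  then have "filterlim (\<lambda>z. (f z, g z)) (nhds (f x) \<times>\<^sub>F nhds (g x)) (at x within S)"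
    by (rule filterlim_Pair)
  from filterlim_compose[OF tendsto_scaleR_Pair this]
  show "((\<lambda>z. f z *\<^sub>R g z) \<longlongrightarrow> f x *\<^sub>R g x) (at x within S)" by simp
qed

text \<open>Without a common point, the distances to the preimages of the \<open>G i\<close> never
  vanish together, so normalising them gives a continuous map into the simplex. Brouwer yields a
  fixed point, and the covering of the face carrying it is violated. Distances are taken between
  coefficient vectors because the space itself need not be metrizable.\<close>

lemma KKM_indexed:
  fixes y :: "nat \<Rightarrow> 'a::topological_real_vector" and G :: "nat \<Rightarrow> 'a set"
  assumes "0 < n" and closed: "\<And>i. i < n \<Longrightarrow> closed (G i)"
    and cover: "\<And>I. I \<subseteq> {..<n} \<Longrightarrow> convex hull (y ` I) \<subseteq> \<Union> (G ` I)"
  shows "(\<Inter>i<n. G i) \<noteq> {}"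
proof
  assume empty: "(\<Inter>i<n. G i) = {}"
  define L where "L c = (\<Sum>i<n. c i *\<^sub>R y i)" for c :: "nat \<Rightarrow> real"
  define g where "g i c = infdist c (L -` G i)" for i c
  \<comment> \<open>\<open>P\<close> retracts the cube onto the standard simplex.\<close>
  define P where "P c = (\<lambda>i. if i < n then
      (c i + max 0 (1 - (\<Sum>j<n. c j)) / real n) / max 1 (\<Sum>j<n. c j) else 0)" for c :: "nat \<Rightarrow> real"
  define T where "T c = (\<lambda>i. if i < n then g i (P c) / (\<Sum>j<n. g j (P c)) else 0)" for c
  have coord: "continuous_on UNIV (\<lambda>c::nat \<Rightarrow> real. c i)" for i
    by simp
  have "continuous_on UNIV L"
    unfolding L_def
    by (intro continuous_on_sum continuous_on_scaleR_topological coord continuous_on_const)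
  then have clF: "closed (L -` G i)" if "i < n" for i
    using closed[OF that] by (simp add: closed_vimage)
  \<comment> \<open>Needed because \<open>infdist\<close> to the empty set is \<open>0\<close>.\<close>
  have F_nonempty: "L -` G i \<noteq> {}" if "i < n" for i
  proof -
    have "L (\<lambda>j. of_bool (j = i)) = y i"
      using that by (simp add: L_def of_bool_def if_distrib[of "\<lambda>a. a *\<^sub>R _"] cong: if_cong)
    moreover have "y i \<in> G i" using cover[of "{i}"] that by simp
    ultimately show ?thesis by blast
  qed
  have g_eq_0: "L c \<in> G i \<longleftrightarrow> g i c = 0" if "i < n" for i c
    using in_closed_iff_infdist_zero[OF clF F_nonempty, OF that that] by (simp add: g_def)
  have g_nonneg: "0 \<le> g i c" for i c
    by (simp add: g_def infdist_nonneg)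
  \<comment> \<open>The assumed emptiness of the intersection enters here; it keeps the denominator
    in \<open>T\<close> away from 0.\<close>
  have g_pos: "0 < (\<Sum>j<n. g j c)" for c
  proof -
    obtain i where "i < n" "L c \<notin> G i" using empty by blast
    then have "0 < g i c" using g_eq_0 g_nonneg by (metis order_le_less)
    then show ?thesis using \<open>i < n\<close> g_nonneg by (intro sum_pos2) auto
  qed
  have contP: "continuous_on UNIV P"
  proof (intro continuous_on_coordinatewise_then_product)
    have "max 1 (\<Sum>j<n. c j) \<noteq> 0" for c :: "nat \<Rightarrow> real" by linarith
    then show "continuous_on UNIV (\<lambda>c. P c i)" for i
      by (cases "i < n")
        (auto simp: P_def intro!: continuous_on_divide continuous_on_add continuous_on_max
          continuous_on_diff continuous_on_sum continuous_on_const coord)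
  qed
  have contT: "continuous_on UNIV T"
  proof (intro continuous_on_coordinatewise_then_product)
    have "continuous_on UNIV (\<lambda>c. g i (P c))" for i
      unfolding g_def by (intro continuous_on_infdist contP)
    then show "continuous_on UNIV (\<lambda>c. T c i)" for i
      using g_pos by (cases "i < n")
        (auto simp: T_def less_imp_neq[THEN not_sym]
          intro!: continuous_on_divide continuous_on_sum continuous_on_const)
  qed
  have T_cube: "T c \<in> cube_upto n" for c
    using g_pos[of "P c"] g_nonneg[of _ "P c"]
    by (auto simp: cube_upto_def T_def intro!: member_le_sum)
  obtain c where c: "c \<in> cube_upto n" "T c = c"
    using brouwer_cube_upto[of n T] contT T_cube continuous_on_subset by blast
  have c_eq: "c i = g i (P c) / (\<Sum>j<n. g j (P c))" if "i < n" for i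
    using fun_cong[OF c(2), of i] that by (simp add: T_def)
  have "(\<Sum>i<n. c i) = 1"
    using g_pos[of "P c"] by (simp add: c_eq flip: sum_divide_distrib)
  \<comment> \<open>With coordinate sum 1 both maxima in \<open>P\<close> become trivial, so the
    fixed point equation speaks of \<open>g i c\<close> itself.\<close>
  then have "P c = c"
    using c(1) by (auto simp: P_def cube_upto_def)
  \<comment> \<open>\<open>I\<close> indexes the smallest face carrying \<open>c\<close>. The
    covering puts \<open>L c\<close> into some \<open>G i\<close> with \<open>i\<close> in
    \<open>I\<close>; then \<open>g i c = 0\<close>, which forces \<open>c i = 0\<close>.\<close>
  define I where "I = {i\<in>{..<n}. c i \<noteq> 0}"
  have c_nonneg: "0 \<le> c i" if "i < n" for i using c(1) that by (simp add: cube_upto_def)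
  have sum_I: "(\<Sum>i\<in>I. c i) = 1"
    unfolding \<open>(\<Sum>i<n. c i) = 1\<close>[symmetric] by (rule sum.mono_neutral_left) (auto simp: I_def)
  have "L c = (\<Sum>i\<in>I. c i *\<^sub>R y i)"
    unfolding L_def by (rule sum.mono_neutral_right) (auto simp: I_def)
  also have "\<dots> \<in> convex hull (y ` I)"
    using sum_I c_nonneg by (intro convex_sum) (auto simp: I_def intro: hull_inc)
  finally have "L c \<in> convex hull (y ` I)" .
  moreover have "convex hull (y ` I) \<subseteq> \<Union> (G ` I)" by (rule cover) (auto simp: I_def)
  ultimately obtain i where "i \<in> I" "L c \<in> G i" by blast
  then have "c i = 0" using c_eq[of i] g_eq_0[of i c] \<open>P c = c\<close> by (auto simp: I_def)
  with \<open>i \<in> I\<close> show False by (simp add: I_def)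
qed

theorem KKM:
  fixes S :: "'a::topological_real_vector set"
  assumes "finite S" "S \<noteq> {}" and "\<And>y. y \<in> S \<Longrightarrow> closed (G y)"
    and cover: "\<And>T. T \<subseteq> S \<Longrightarrow> convex hull T \<subseteq> \<Union> (G ` T)"
  shows "(\<Inter>y\<in>S. G y) \<noteq> {}"
proof -
  obtain h where h: "bij_betw h {..<card S} S"
    using ex_bij_betw_nat_finite[OF \<open>finite S\<close>] by (auto simp: atLeast0LessThan)
  then have S: "S = h ` {..<card S}" by (simp add: bij_betw_def)
  have "(\<Inter>i<card S. G (h i)) \<noteq> {}"
  proof (rule KKM_indexed[of _ _ h])
    show "0 < card S" using assms by (simp add: card_gt_0_iff)
    show "closed (G (h i))" if "i < card S" for i using that assms(3) S by blast
    show "convex hull (h ` I) \<subseteq> (\<Union>i\<in>I. G (h i))" if "I \<subseteq> {..<card S}" for I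
      using cover[of "h ` I"] that S by (auto simp: image_comp)
  qed
  then show ?thesis by (subst S) simp
qed

section \<open>Consequences of self segment-density, convexity on \<open>D\<close> and upper
  semicontinuity\<close>

lemma self_segment_dense_in_convex_hull:
  fixes U :: "'a::topological_real_vector set"
  assumes "self_segment_dense_in U V" "finite T" "T \<subseteq> U"
  shows "convex hull T \<subseteq> closure (convex hull T \<inter> U)"
  using assms(2,3)
proof (induction T)
  case empty
  then show ?case by simp
next
  case (insert a T)
  show ?case
  proof (cases "T = {}")
    case True
    then show ?thesis using insert.prems closure_subset[of "{a}"] by auto
  next
    case False
    let ?C = "closure (convex hull (insert a T) \<inter> U)"
    show ?thesis
    proof
      fix x assume "x \<in> convex hull (insert a T)"
      then obtain u b where u: "0 \<le> u" "u \<le> 1" and b: "b \<in> convex hull T"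
        and x: "x = (1 - u) *\<^sub>R a + u *\<^sub>R b"
        using False by (auto simp: convex_hull_insert_alt)
      \<comment> \<open>Segment density requires both endpoints in \<open>U\<close>, and
        \<open>b\<close> may lie outside. The induction hypothesis approximates \<open>b\<close> by
        points \<open>z\<close> of \<open>U\<close> in the smaller hull; for these the segment from
        \<open>a\<close> to \<open>z\<close> can be used, and continuity of \<open>?h\<close>
        carries the result over to \<open>b\<close>.\<close>
      let ?h = "\<lambda>b. (1 - u) *\<^sub>R a + u *\<^sub>R b"
      have "?h ` closure (convex hull T \<inter> U) \<subseteq> ?C"
      proof (rule image_closure_subset)
        show "continuous_on (closure (convex hull T \<inter> U)) ?h"
          by (intro continuous_on_add continuous_on_scaleR_topological continuous_on_const continuous_on_id)
        show "?h ` (convex hull T \<inter> U) \<subseteq> ?C"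
        proof clarify
          fix z assume z: "z \<in> convex hull T" "z \<in> U"
          have "closed_segment a z \<subseteq> convex hull (insert a T)"
            using z(1) hull_mono[of T "insert a T" convex]
            by (intro closed_segment_subset convex_convex_hull) (auto intro: hull_inc)
          then have "closure (closed_segment a z \<inter> U) \<subseteq> ?C"
            by (intro closure_mono) auto
          moreover have "closed_segment a z \<subseteq> closure (closed_segment a z \<inter> U)"
            using assms(1) z(2) insert.prems by (auto simp: self_segment_dense_in_def)
          moreover have "?h z \<in> closed_segment a z"
            using u by (auto simp: closed_segment_def)
          ultimately show "?h z \<in> ?C" by blast
        qed
      qed simp
      moreover have "b \<in> closure (convex hull T \<inter> U)" using b insert by blast
      ultimately show "x \<in> ?C" unfolding x by blast
    qed
  qed
qed

text \<open>A weighted mean of negative values is negative, as some weight is positive. Used with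
  \<open>f\<close> = \<open>\<phi> x\<close>, this contradicts (iv) at the point
  \<open>x\<close>.\<close>

lemma convex_fun_on_convex_hull_neg:
  assumes "convex_fun_on D f" "T \<subseteq> D" "x \<in> convex hull T" "x \<in> D" "\<And>t. t \<in> T \<Longrightarrow> f t < 0"
  shows "f x < 0"
proof -
  obtain k :: nat and u z where uz: "\<forall>i\<in>{1..k}. 0 \<le> u i \<and> z i \<in> T"
    and u1: "sum u {1..k} = 1" and x: "(\<Sum>i = 1..k. u i *\<^sub>R z i) = x"
    using assms(3) by (auto simp: convex_hull_indexed)
  have "f x \<le> (\<Sum>i = 1..k. u i * f (z i))"
    using assms uz u1 x unfolding convex_fun_on_def by blast
  also have "\<dots> < 0"
  proof -
    have "\<exists>i\<in>{1..k}. u i \<noteq> 0"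
      using u1 by (metis sum.neutral zero_neq_one)
    then obtain i where i: "i \<in> {1..k}" "u i > 0" using uz by force
    have "(\<Sum>i = 1..k. u i * f (z i)) < (\<Sum>i = 1..k. 0)"
      by (rule sum_strict_mono_ex1)
        (use uz assms(5) i in \<open>auto simp: mult_le_0_iff mult_less_0_iff less_imp_le intro!: bexI[of _ i]\<close>)
    then show ?thesis by simp
  qed
  finally show ?thesis .
qed

lemma closed_superlevel:
  fixes f :: "'a::topological_space \<Rightarrow> real"
  assumes "upper_semicontinuous_on K K f" "closed K"
  shows "closed {x\<in>K. a \<le> f x}"
  unfolding closed_def
proof (subst open_subopen, intro ballI)
  fix x assume x: "x \<in> - {x\<in>K. a \<le> f x}"
  show "\<exists>W. open W \<and> x \<in> W \<and> W \<subseteq> - {x\<in>K. a \<le> f x}"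
  proof (cases "x \<in> K")
    case True
    then have "\<forall>\<^sub>F z in at x within K. f z < a"
      using assms(1) x by (auto simp: upper_semicontinuous_on_def upper_semicontinuous_at_within_def)
    then obtain W where "open W" "x \<in> W" "\<And>z. z \<in> W \<Longrightarrow> z \<noteq> x \<Longrightarrow> z \<in> K \<Longrightarrow> f z < a"
      by (auto simp: eventually_at_topological)
    \<comment> \<open>The filter omits \<open>x\<close> itself, where \<open>f x < a\<close> holds
      by the choice of \<open>x\<close>.\<close>
    with x show ?thesis by (intro exI[of _ W]) force
  next
    case False
    then show ?thesis using assms(2) by (intro exI[of _ "- K"]) auto
  qed
qed

section \<open>Existence of the solution \<open>x0\<close>\<close>

theorem theorem4p3:
  fixes K D :: "'a::{locally_convex_space, t2_space} set"
    and \<phi> :: "'a \<Rightarrow> 'a \<Rightarrow> real"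
  assumes K: "K \<noteq> {}" "convex K" "closed K"
    and D: "D \<subseteq> K" "self_segment_dense_in D K"
    and i: "\<And>y. y \<in> D \<Longrightarrow> upper_semicontinuous_on K K (\<lambda>x. \<phi> x y)"
    and ii: "\<And>x. x \<in> K \<Longrightarrow> upper_semicontinuous_on K (K - D) (\<lambda>y. \<phi> x y)"
    and iii: "\<And>x. x \<in> D \<Longrightarrow> convex_fun_on D (\<lambda>y. \<phi> x y)"
    and iv: "\<And>x. x \<in> D \<Longrightarrow> \<phi> x x \<ge> 0"
    and v: "\<exists>K0. compact K0 \<and> (\<exists>y0\<in>D \<inter> K0. \<forall>x\<in>K - K0. \<phi> x y0 < 0)"
  shows "\<exists>x0\<in>K. \<forall>y\<in>K. \<phi> x0 y \<ge> 0"
proof -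
  obtain K0 y0 where K0: "compact K0" and y0: "y0 \<in> D" "y0 \<in> K0"
    and neg: "\<And>x. x \<in> K - K0 \<Longrightarrow> \<phi> x y0 < 0"
    using v by blast
  define G where "G y = {x\<in>K. 0 \<le> \<phi> x y}" for y
  have clG: "closed (G y)" if "y \<in> D" for y
    unfolding G_def by (intro closed_superlevel i that K)
  have "G y0 \<subseteq> K0" using neg by (force simp: G_def)
  have fip: "(\<Inter>y\<in>S. G y) \<noteq> {}" if "finite S" "S \<noteq> {}" "S \<subseteq> D" for S
  proof (rule KKM[OF that(1,2)])
    show "closed (G y)" if "y \<in> S" for y using that \<open>S \<subseteq> D\<close> clG by blast
    fix T assume "T \<subseteq> S"
    then have T: "finite T" "T \<subseteq> D" using that finite_subset by auto
    \<comment> \<open>Conditions (iii) and (iv) speak only of points \<open>x\<close> of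
      \<open>D\<close>, so the covering is first obtained there; closedness of the finite union then
      extends it to the hull.\<close>
    have "convex hull T \<inter> D \<subseteq> \<Union> (G ` T)"
    proof
      fix x assume x: "x \<in> convex hull T \<inter> D"
      then have "\<exists>y\<in>T. 0 \<le> \<phi> x y"
        using convex_fun_on_convex_hull_neg[OF iii T(2), of x x] iv[of x] by force
      then show "x \<in> \<Union> (G ` T)" using x D(1) by (auto simp: G_def)
    qed
    moreover have "closed (\<Union> (G ` T))" using T clG by (intro closed_Union) auto
    ultimately have "closure (convex hull T \<inter> D) \<subseteq> \<Union> (G ` T)" by (rule closure_minimal)
    then show "convex hull T \<subseteq> \<Union> (G ` T)"
      using self_segment_dense_in_convex_hull[OF D(2) T] by blast
  qed
  have "K0 \<inter> (\<Inter>y\<in>D. G y) \<noteq> {}"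
  proof (rule compact_imp_fip_image[OF K0 clG])
    fix S assume "finite S" "S \<subseteq> D"
    \<comment> \<open>Adding \<open>y0\<close> confines the common point to \<open>K0\<close> and
      also covers the case of empty \<open>S\<close>.\<close>
    then have "(\<Inter>y\<in>insert y0 S. G y) \<noteq> {}" using y0 by (intro fip) auto
    then show "K0 \<inter> (\<Inter>y\<in>S. G y) \<noteq> {}" using \<open>G y0 \<subseteq> K0\<close> by auto
  qed
  then obtain x0 where x0: "\<And>y. y \<in> D \<Longrightarrow> x0 \<in> G y" by blast
  then have "x0 \<in> K" using y0 by (auto simp: G_def)
  moreover have "0 \<le> \<phi> x0 y" if "y \<in> K" for y
  proof (rule ccontr)
    assume "\<not> 0 \<le> \<phi> x0 y"
    moreover from this have "y \<notin> D" using x0 by (auto simp: G_def)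
    ultimately have "\<forall>\<^sub>F z in at y within K. \<phi> x0 z < 0"
      using ii[OF \<open>x0 \<in> K\<close>] \<open>y \<in> K\<close>
      by (auto simp: upper_semicontinuous_on_def upper_semicontinuous_at_within_def)
    then obtain W where W: "open W" "y \<in> W" "\<And>z. z \<in> W \<Longrightarrow> z \<noteq> y \<Longrightarrow> z \<in> K \<Longrightarrow> \<phi> x0 z < 0"
      by (auto simp: eventually_at_topological)
    have "y \<in> closure D" using D(2) \<open>y \<in> K\<close> by (auto simp: self_segment_dense_in_def)
    then obtain z where z: "z \<in> D" "z \<in> W"
      using W(1,2) by (meson closure_iff_nhds_not_empty disjoint_iff order_refl)
    \<comment> \<open>As \<open>y\<close> is outside \<open>D\<close>, \<open>z\<close> differs from
      \<open>y\<close>, so the punctured neighbourhood suffices.\<close>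
    then have "\<phi> x0 z < 0" using W(3) D(1) \<open>y \<notin> D\<close> by blast
    then show False using x0[OF z(1)] by (simp add: G_def)
  qed
  ultimately show ?thesis by blast
qed

end
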